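(* Let $X$ be a finite-dimensional complex Banach space and let $T:X\to X$ be a diffeomorphism with fixed point $0$, having a power series around $0$, whose differential $T'(0)$ is diagonalizable with nonzero eigenvalues. Then every element of the principle algebra $\mathcal A_{T'(0)}$ (with or without the constant functions appended) is a finite linear combination of eigenfunctions of the Koopman operator $U_{T'(0)}$.
   Context: The Koopman operator $U_{T'(0)}:C(X)\to C(X)$ acts on the space $C(X)$ of complex continuous functions on $X$ by $(U_{T'(0)}f)(x)=f(T'(0)x)$. Let $n=\dim X$, let $\{e_1,\dots,e_n\}$ be a basis of $X$ of eigenvectors of $T'(0)$, $T'(0)e_i=\lambda_ie_i$, and let $\{\phi_1,\dots,\phi_n\}\subset X^*$ be the associated coordinate functionals (dual basis); these are called the principle eigenfunctions of $U_{T'(0)}$. The principle algebra $\mathcal A_{T'(0)}\subset C(X)$ is the complex algebra (pointwise multiplication) generated by $\phi_1,\dots,\phi_n$; it can be made unital by appending the constant functions. *)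

theory Defs
  imports "HOL-Analysis.Analysis"
begin

section \<open>Complex Banach spaces\<close>

class complex_banach = banach +
  fixes scaleC :: "complex \<Rightarrow> 'a \<Rightarrow> 'a"  (infixr \<open>*\<^sub>C\<close> 75)
  assumes scaleC_add_right: "a *\<^sub>C (x + y) = a *\<^sub>C x + a *\<^sub>C y"
    and scaleC_add_left: "(a + b) *\<^sub>C x = a *\<^sub>C x + b *\<^sub>C x"
    and scaleC_scaleC: "a *\<^sub>C b *\<^sub>C x = (a * b) *\<^sub>C x"
    and scaleC_of_real: "complex_of_real r *\<^sub>C x = r *\<^sub>R x"
    and norm_scaleC: "norm (a *\<^sub>C x) = cmod a * norm x"

instantiation complex :: complex_banach
begin

definition scaleC_complex :: "complex \<Rightarrow> complex \<Rightarrow> complex"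
  where "scaleC_complex a x = a * x"

instance
  by standard
    (auto simp: scaleC_complex_def algebra_simps norm_mult scaleR_conv_of_real)

end

global_interpretation complex_vector:
  vector_space "scaleC :: complex \<Rightarrow> 'a \<Rightarrow> 'a::complex_banach"
proof
  show "1 *\<^sub>C x = x" for x :: 'a
    using scaleC_of_real[of 1 x] by simp
qed (simp_all add: scaleC_add_right scaleC_add_left scaleC_scaleC)

abbreviation clinear :: "('a::complex_banach \<Rightarrow> 'b::complex_banach) \<Rightarrow> bool"
  where "clinear \<equiv> Vector_Spaces.linear scaleC scaleC"


section \<open>Diffeomorphisms and power series\<close>

text \<open>
  Smoothness refers to the underlying real Banach space, so that a C1 diffeomorphism need not be
  holomorphic away from the origin.
\<close>

definition C1_map :: "('a::real_normed_vector \<Rightarrow> 'b::real_normed_vector) \<Rightarrow> bool"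
  where "C1_map f \<longleftrightarrow>
    (\<exists>D :: 'a \<Rightarrow> 'a \<Rightarrow>\<^sub>L 'b.
      (\<forall>x. (f has_derivative blinfun_apply (D x)) (at x)) \<and> continuous_on UNIV D)"

definition diffeomorphism :: "('a::real_normed_vector \<Rightarrow> 'b::real_normed_vector) \<Rightarrow> bool"
  where "diffeomorphism f \<longleftrightarrow> bij f \<and> C1_map f \<and> C1_map (inv f)"

text \<open>A \<open>k\<close>-linear map takes the list of its \<open>k\<close> arguments; on other lists it is irrelevant.\<close>

definition bounded_multilinear ::
    "nat \<Rightarrow> ('a::complex_banach list \<Rightarrow> 'b::complex_banach) \<Rightarrow> bool"
  where "bounded_multilinear k A \<longleftrightarrow>
    (\<forall>xs i. length xs = k \<longrightarrow> i < k \<longrightarrow> clinear (\<lambda>x. A (xs[i := x]))) \<and>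
    (\<exists>C. \<forall>xs. length xs = k \<longrightarrow> norm (A xs) \<le> C * prod_list (map norm xs))"

definition homogeneous_polynomial ::
    "nat \<Rightarrow> ('a::complex_banach \<Rightarrow> 'b::complex_banach) \<Rightarrow> bool"
  where "homogeneous_polynomial k P \<longleftrightarrow>
    (\<exists>A. bounded_multilinear k A \<and> (\<forall>x. P x = A (replicate k x)))"

definition has_power_series_at_0 :: "('a::complex_banach \<Rightarrow> 'b::complex_banach) \<Rightarrow> bool"
  where "has_power_series_at_0 f \<longleftrightarrow>
    (\<exists>r P. r > 0 \<and> (\<forall>k. homogeneous_polynomial k (P k)) \<and>
      uniform_limit (ball 0 r) (\<lambda>N x. \<Sum>k<N. P k x) f sequentially)"


section \<open>Bases of eigenvectors and coordinate functionals\<close>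

definition is_eigenvector :: "('a::complex_banach \<Rightarrow> 'a) \<Rightarrow> complex \<Rightarrow> 'a \<Rightarrow> bool"
  where "is_eigenvector L \<mu> v \<longleftrightarrow> v \<noteq> 0 \<and> L v = \<mu> *\<^sub>C v"

definition is_basis :: "nat \<Rightarrow> (nat \<Rightarrow> 'a::complex_banach) \<Rightarrow> bool"
  where "is_basis n e \<longleftrightarrow> inj_on e {1..n} \<and>
    complex_vector.independent (e ` {1..n}) \<and> complex_vector.span (e ` {1..n}) = UNIV"

definition diagonalizable :: "('a::complex_banach \<Rightarrow> 'a) \<Rightarrow> bool"
  where "diagonalizable L \<longleftrightarrow> clinear L \<and>
    (\<exists>n e lam. is_basis n e \<and> (\<forall>i\<in>{1..n}. is_eigenvector L (lam i) (e i)))"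

definition coordinate_functional ::
    "nat \<Rightarrow> (nat \<Rightarrow> 'a::complex_banach) \<Rightarrow> nat \<Rightarrow> 'a \<Rightarrow> complex"
  where "coordinate_functional n e i x = complex_vector.representation (e ` {1..n}) x (e i)"


section \<open>The Koopman operator and the principle algebra\<close>

definition continuous_functions :: "('a::topological_space \<Rightarrow> complex) set"
  where "continuous_functions = {f. continuous_on UNIV f}"

definition koopman :: "('a \<Rightarrow> 'a) \<Rightarrow> ('a \<Rightarrow> complex) \<Rightarrow> 'a \<Rightarrow> complex"
  where "koopman S f = (\<lambda>x. f (S x))"

definition koopman_eigenfunction ::
    "('a::topological_space \<Rightarrow> 'a) \<Rightarrow> ('a \<Rightarrow> complex) \<Rightarrow> bool"
  where "koopman_eigenfunction S f \<longleftrightarrow> f \<in> continuous_functions \<and> f \<noteq> (\<lambda>x. 0) \<and>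
    (\<exists>\<mu>. koopman S f = (\<lambda>x. \<mu> * f x))"

text \<open>The generated algebra is not required to contain the constants.\<close>

inductive_set generated_algebra :: "('a \<Rightarrow> complex) set \<Rightarrow> ('a \<Rightarrow> complex) set"
  for G :: "('a \<Rightarrow> complex) set"
  where
    generator: "g \<in> G \<Longrightarrow> g \<in> generated_algebra G"
  | zero: "(\<lambda>x. 0) \<in> generated_algebra G"
  | add: "\<lbrakk>f \<in> generated_algebra G; g \<in> generated_algebra G\<rbrakk>
      \<Longrightarrow> (\<lambda>x. f x + g x) \<in> generated_algebra G"
  | scale: "f \<in> generated_algebra G \<Longrightarrow> (\<lambda>x. c * f x) \<in> generated_algebra G"
  | mult: "\<lbrakk>f \<in> generated_algebra G; g \<in> generated_algebra G\<rbrakk>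
      \<Longrightarrow> (\<lambda>x. f x * g x) \<in> generated_algebra G"

definition principle_algebra :: "nat \<Rightarrow> (nat \<Rightarrow> 'a::complex_banach) \<Rightarrow> ('a \<Rightarrow> complex) set"
  where "principle_algebra n e = generated_algebra (coordinate_functional n e ` {1..n})"

definition unital_principle_algebra ::
    "nat \<Rightarrow> (nat \<Rightarrow> 'a::complex_banach) \<Rightarrow> ('a \<Rightarrow> complex) set"
  where "unital_principle_algebra n e =
    generated_algebra (principle_algebra n e \<union> range (\<lambda>c x. c))"

definition is_finite_linear_combination ::
    "('a \<Rightarrow> complex) set \<Rightarrow> ('a \<Rightarrow> complex) \<Rightarrow> bool"
  where "is_finite_linear_combination E f \<longleftrightarrow>
    (\<exists>F c. finite F \<and> F \<subseteq> E \<and> f = (\<lambda>x. \<Sum>g\<in>F. c g * g x))"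

end

theory Submission
  imports Defs
begin

text \<open>
  The coordinate functional \<open>\<phi>\<^sub>i\<close> satisfies \<open>\<phi>\<^sub>i (T'(0) x) = \<lambda>\<^sub>i \<phi>\<^sub>i x\<close>, and it is continuous because
  linear functionals on a finite-dimensional space are bounded. So it is a Koopman eigenfunction.
  A product of eigenfunctions is again an eigenfunction (or zero), with the product of the
  eigenvalues, so the linear span of the eigenfunctions is an algebra. It contains the constants,
  which have eigenvalue \<open>1\<close>.
\<close>

section \<open>Boundedness of coordinates\<close>

text \<open>The bound turns a convergent sequence in the span into Cauchy sequences of coefficients.
  These converge because the complex numbers are complete, and the limit coefficients represent the
  limit vector. This feeds the induction step of the next lemma.\<close>

lemma closed_span_if_coefficients_bounded:
  fixes B :: "'a::complex_banach set"
  assumes "finite B"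
    and bound: "\<And>c b. b \<in> B \<Longrightarrow> cmod (c b) \<le> C * norm (\<Sum>v\<in>B. c v *\<^sub>C v)"
  shows "closed (complex_vector.span B)"
  unfolding closed_sequential_limits
proof (intro allI impI, elim conjE)
  fix x l
  assume "\<forall>k. x k \<in> complex_vector.span B" and lim: "x \<longlonglongrightarrow> l"
  then have "\<forall>k. \<exists>u. x k = (\<Sum>v\<in>B. u v *\<^sub>C v)"
    unfolding complex_vector.span_finite[OF \<open>finite B\<close>] by auto
  then obtain u where x: "\<And>k. x k = (\<Sum>v\<in>B. u k v *\<^sub>C v)"
    by metis
  \<comment> \<open>The difference of two members of the sequence has the coefficientwise
    differences as its coefficients, so the bound applies to it.\<close>
  have dist_u: "dist (u k b) (u m b) \<le> C * dist (x k) (x m)" if "b \<in> B" for k m b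
    using bound[OF that, of "\<lambda>v. u k v - u m v"]
    by (simp add: x dist_norm complex_vector.scale_left_diff_distrib sum_subtractf)
  have "Cauchy (\<lambda>k. u k b)" if "b \<in> B" for b
  proof (rule metric_CauchyI)
    fix \<epsilon> :: real
    assume "\<epsilon> > 0"
    \<comment> \<open>The sign of \<open>C\<close> is unknown here, and
      \<open>\<bar>C\<bar> + 1\<close> is a positive upper bound for it.\<close>
    then have "\<epsilon> / (\<bar>C\<bar> + 1) > 0"
      by simp
    then obtain M where M: "\<And>k m. k \<ge> M \<Longrightarrow> m \<ge> M \<Longrightarrow> dist (x k) (x m) < \<epsilon> / (\<bar>C\<bar> + 1)"
      using metric_CauchyD[OF LIMSEQ_imp_Cauchy[OF lim]] by metis
    have "dist (u k b) (u m b) < \<epsilon>" if "k \<ge> M" "m \<ge> M" for k m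
    proof -
      have "dist (u k b) (u m b) \<le> (\<bar>C\<bar> + 1) * dist (x k) (x m)"
        by (rule order_trans[OF dist_u[OF \<open>b \<in> B\<close>]]) (intro mult_right_mono, auto)
      also have "\<dots> < \<epsilon>"
        using M[OF that] by (simp add: field_simps)
      finally show ?thesis .
    qed
    then show "\<exists>M. \<forall>k\<ge>M. \<forall>m\<ge>M. dist (u k b) (u m b) < \<epsilon>"
      by blast
  qed
  then have "\<forall>b\<in>B. \<exists>w. (\<lambda>k. u k b) \<longlonglongrightarrow> w"
    using Cauchy_convergent_iff convergent_def by blast
  then obtain w where w: "\<And>b. b \<in> B \<Longrightarrow> (\<lambda>k. u k b) \<longlonglongrightarrow> w b"
    by metis
  have "(\<lambda>k. u k b *\<^sub>C b) \<longlonglongrightarrow> w b *\<^sub>C b" if "b \<in> B" for b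
  proof -
    have "(\<lambda>k. cmod (u k b - w b) * norm b) \<longlonglongrightarrow> 0"
      using w[OF that] by (auto intro!: tendsto_mult_left_zero tendsto_norm_zero simp: LIM_zero)
    then show ?thesis
      unfolding tendsto_dist_iff[of _ "w b *\<^sub>C b"]
      by (simp add: dist_norm norm_scaleC flip: complex_vector.scale_left_diff_distrib)
  qed
  then have "x \<longlonglongrightarrow> (\<Sum>v\<in>B. w v *\<^sub>C v)"
    unfolding x by (rule tendsto_sum)
  then have "l = (\<Sum>v\<in>B. w v *\<^sub>C v)"
    using lim LIMSEQ_unique by blast
  then show "l \<in> complex_vector.span B"
    by (simp add: complex_vector.span_sum complex_vector.span_scale complex_vector.span_base)
qed

text \<open>Induction on the basis: by the bound for \<open>B\<close> its span is closed, so a new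
  independent vector \<open>a\<close> has positive distance from it. That distance controls the
  coefficient of \<open>a\<close>; subtracting the \<open>a\<close>-part leaves a vector of the span
  of \<open>B\<close>, to which the induction hypothesis applies.\<close>

lemma independent_coefficients_bounded:
  fixes B :: "'a::complex_banach set"
  assumes "finite B" and "complex_vector.independent B"
  shows "\<exists>C\<ge>0. \<forall>c. \<forall>b\<in>B. cmod (c b) \<le> C * norm (\<Sum>v\<in>B. c v *\<^sub>C v)"
  using assms
proof (induction B rule: finite_induct)
  case empty
  then show ?case
    by auto
next
  case (insert a B)
  have indep: "complex_vector.independent B" and a: "a \<notin> complex_vector.span B"
    using insert.prems insert.hyps(2) by (auto simp: complex_vector.independent_insert)
  obtain C where "C \<ge> 0" and C: "\<And>c b. b \<in> B \<Longrightarrow> cmod (c b) \<le> C * norm (\<Sum>v\<in>B. c v *\<^sub>C v)"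
    using insert.IH[OF indep] by blast
  have "closed (complex_vector.span B)"
    using closed_span_if_coefficients_bounded[OF insert.hyps(1) C] .
  then have "open (- complex_vector.span B)"
    by (rule open_Compl)
  then obtain d where "d > 0" and "ball a d \<subseteq> - complex_vector.span B"
    using a by (auto elim!: openE)
  then have d: "d \<le> dist a y" if "y \<in> complex_vector.span B" for y
    using that by (force simp: not_less)
  \<comment> \<open>The first summand serves the coefficient of \<open>a\<close>, the second those
    of \<open>B\<close>; both are nonnegative, so their sum serves all.\<close>
  define D where "D = 1 / d + C * (1 + norm a / d)"
  have "D \<ge> 0"
    using \<open>C \<ge> 0\<close> \<open>d > 0\<close> by (simp add: D_def)
  moreover have "cmod (c b) \<le> D * norm (\<Sum>v\<in>insert a B. c v *\<^sub>C v)" if "b \<in> insert a B" for c b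
  proof -
    define s where "s = (\<Sum>v\<in>B. c v *\<^sub>C v)"
    define x where "x = c a *\<^sub>C a + s"
    have s_span: "s \<in> complex_vector.span B"
      unfolding s_def
      by (simp add: complex_vector.span_sum complex_vector.span_scale complex_vector.span_base)
    have c_a: "cmod (c a) \<le> norm x / d"
    proof (cases "c a = 0")
      case True
      then show ?thesis
        using \<open>d > 0\<close> by simp
    next
      case False
      \<comment> \<open>Dividing \<open>x\<close> by \<open>c a\<close> gives \<open>a\<close> minus
        a vector of the span of \<open>B\<close>, which has norm at least \<open>d\<close>.\<close>
      have "d \<le> dist a ((- 1 / c a) *\<^sub>C s)"
        by (intro d complex_vector.span_scale s_span)
      then have "cmod (c a) * d \<le> norm (c a *\<^sub>C (a - (- 1 / c a) *\<^sub>C s))"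
        unfolding norm_scaleC dist_norm by (rule mult_left_mono) simp
      also have "c a *\<^sub>C (a - (- 1 / c a) *\<^sub>C s) = x"
        using False by (simp add: x_def complex_vector.scale_right_distrib)
      finally show ?thesis
        using \<open>d > 0\<close> by (simp only: pos_le_divide_eq)
    qed
    have "norm s \<le> norm x + norm (c a *\<^sub>C a)"
      using norm_triangle_ineq4[of x "c a *\<^sub>C a"] by (simp add: x_def)
    also have "\<dots> \<le> norm x + norm x / d * norm a"
      using mult_right_mono[OF c_a, of "norm a"] by (simp add: norm_scaleC)
    finally have s: "norm s \<le> (1 + norm a / d) * norm x"
      by (simp add: algebra_simps)
    have "cmod (c b) \<le> D * norm x"
    proof (cases "b = a")
      case True
      have "norm x / d \<le> D * norm x"
        using \<open>C \<ge> 0\<close> \<open>d > 0\<close> by (simp add: D_def distrib_right)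
      with c_a True show ?thesis
        by simp
    next
      case False
      then have "cmod (c b) \<le> C * norm s"
        using C that by (simp add: s_def)
      also have "\<dots> \<le> C * ((1 + norm a / d) * norm x)"
        using s \<open>C \<ge> 0\<close> by (rule mult_left_mono)
      also have "\<dots> \<le> D * norm x"
        using \<open>d > 0\<close> by (simp add: D_def algebra_simps)
      finally show ?thesis .
    qed
    then show ?thesis
      using insert.hyps by (simp add: x_def s_def)
  qed
  ultimately show ?case
    by blast
qed

text \<open>The coefficient bound, applied to the representation of a vector, bounds the functional
  by a multiple of the norm; by linearity it is then Lipschitz.\<close>

lemma continuous_on_coordinate_functional:
  assumes "is_basis n e" and "i \<in> {1..n}"
  shows "continuous_on UNIV (coordinate_functional n e i)"
proof -
  let ?B = "e ` {1..n}"
  have B: "complex_vector.independent ?B" "\<And>x. x \<in> complex_vector.span ?B"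
    using assms(1) by (auto simp: is_basis_def)
  obtain C where "C \<ge> 0"
    and C: "\<And>c b. b \<in> ?B \<Longrightarrow> cmod (c b) \<le> C * norm (\<Sum>v\<in>?B. c v *\<^sub>C v)"
    using independent_coefficients_bounded[OF _ B(1)] by auto
  have bound: "cmod (coordinate_functional n e i x) \<le> C * norm x" for x
    using C[of "e i" "complex_vector.representation ?B x"] assms(2)
      complex_vector.sum_representation_eq[OF B(1,2), of ?B]
    by (simp add: coordinate_functional_def)
  have "C-lipschitz_on UNIV (coordinate_functional n e i)"
  proof (rule lipschitz_onI)
    fix x y
    show "dist (coordinate_functional n e i x) (coordinate_functional n e i y) \<le> C * dist x y"
      using bound[of "x - y"]
      unfolding dist_norm coordinate_functional_def
        complex_vector.representation_diff[OF B(1,2,2)] .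
  qed fact
  then show ?thesis
    by (rule lipschitz_on_continuous_on)
qed

section \<open>Koopman eigenfunctions\<close>

text \<open>Both sides are linear in \<open>x\<close>, so it suffices to compare them on the basis,
  where \<open>L\<close> is diagonal and the coordinate is a Kronecker delta.\<close>

lemma coordinate_functional_eigenvector:
  assumes "is_basis n e" and "clinear L" and "\<forall>i\<in>{1..n}. is_eigenvector L (lam i) (e i)"
    and i: "i \<in> {1..n}"
  shows "coordinate_functional n e i (L x) = lam i * coordinate_functional n e i x"
proof -
  have L: "L (x + y) = L x + L y" "L (a *\<^sub>C x) = a *\<^sub>C L x" for a x y
    using assms(2) by (simp_all add: Vector_Spaces.linear_iff)
  have L0: "L 0 = 0"
    using L(2)[of 0 0] by simp
  define B where "B = e ` {1..n}"
  have B: "complex_vector.independent B" "x \<in> complex_vector.span B"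
    and inj: "inj_on e {1..n}" for x
    using assms(1) by (simp_all add: is_basis_def B_def)
  note rep = complex_vector.representation_add[OF B(1) B(2) B(2)]
    complex_vector.representation_scale[OF B(1) B(2)] complex_vector.representation_zero
  show ?thesis
    unfolding coordinate_functional_def B_def[symmetric]
  proof (rule complex_vector.span_induct[OF B(2), where P = "\<lambda>x.
        complex_vector.representation B (L x) (e i) =
        lam i * complex_vector.representation B x (e i)"])
    show "complex_vector.subspace {x. complex_vector.representation B (L x) (e i) =
        lam i * complex_vector.representation B x (e i)}"
      by (rule complex_vector.subspaceI) (simp_all add: rep L L0 algebra_simps)
  next
    fix b
    assume b: "b \<in> B"
    then obtain j where j: "j \<in> {1..n}" "b = e j"
      by (auto simp: B_def)
    then have "L b = lam j *\<^sub>C b"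
      using assms(3) by (simp add: is_eigenvector_def)
    \<comment> \<open>Representations are indexed by basis vectors; injectivity of \<open>e\<close>
      translates this to indices and so matches \<open>lam j\<close> with
      \<open>lam i\<close>.\<close>
    moreover have "e j = e i \<longleftrightarrow> j = i"
      using inj_on_eq_iff[OF inj j(1) i] .
    ultimately show "complex_vector.representation B (L b) (e i) =
        lam i * complex_vector.representation B b (e i)"
      using j(2) complex_vector.representation_basis[OF B(1) b] by (auto simp: rep)
  qed
qed

lemma coordinate_functional_eigenfunction:
  assumes "is_basis n e" and "clinear L" and "\<forall>i\<in>{1..n}. is_eigenvector L (lam i) (e i)"
    and "i \<in> {1..n}"
  shows "koopman_eigenfunction L (coordinate_functional n e i)"
proof -
  have "coordinate_functional n e i (e i) = 1"
    using assms(1,4)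
    by (simp add: coordinate_functional_def is_basis_def complex_vector.representation_basis)
  then have "coordinate_functional n e i \<noteq> (\<lambda>x. 0)"
    by (metis zero_neq_one)
  then show ?thesis
    using continuous_on_coordinate_functional[OF assms(1,4)]
      coordinate_functional_eigenvector[OF assms]
    unfolding koopman_eigenfunction_def koopman_def continuous_functions_def by auto
qed

text \<open>Composition with \<open>S\<close> respects products, so the eigenvalues multiply.
  Nonvanishing is assumed because nonzero functions can have product zero.\<close>

lemma koopman_eigenfunction_mult:
  assumes "koopman_eigenfunction S f" and "koopman_eigenfunction S g"
    and "(\<lambda>x. f x * g x) \<noteq> (\<lambda>x. 0)"
  shows "koopman_eigenfunction S (\<lambda>x. f x * g x)"
proof -
  obtain \<mu> \<nu> where "\<And>x. f (S x) = \<mu> * f x" "\<And>x. g (S x) = \<nu> * g x"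
    using assms(1,2) unfolding koopman_eigenfunction_def koopman_def by metis
  then have "koopman S (\<lambda>x. f x * g x) = (\<lambda>x. (\<mu> * \<nu>) * (f x * g x))"
    by (simp add: koopman_def fun_eq_iff)
  with assms show ?thesis
    unfolding koopman_eigenfunction_def continuous_functions_def
    by (auto intro: continuous_on_mult)
qed

lemma koopman_eigenfunction_const:
  assumes "c \<noteq> 0"
  shows "koopman_eigenfunction S (\<lambda>x. c)"
  using assms
  by (auto simp: koopman_eigenfunction_def continuous_functions_def koopman_def fun_eq_iff
      intro!: exI[of _ 1])

section \<open>Finite linear combinations\<close>

lemma is_finite_linear_combination_zero: "is_finite_linear_combination E (\<lambda>x. 0)"
  unfolding is_finite_linear_combination_def by (rule exI[of _ "{}"]) simp

lemma is_finite_linear_combination_base: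
  "f \<in> E \<Longrightarrow> is_finite_linear_combination E f"
  unfolding is_finite_linear_combination_def
  by (rule exI[of _ "{f}"], rule exI[of _ "\<lambda>_. 1"]) simp

lemma is_finite_linear_combination_scale:
  assumes "is_finite_linear_combination E f"
  shows "is_finite_linear_combination E (\<lambda>x. a * f x)"
proof -
  obtain F c where "finite F" "F \<subseteq> E" "f = (\<lambda>x. \<Sum>g\<in>F. c g * g x)"
    using assms unfolding is_finite_linear_combination_def by blast
  then have "finite F \<and> F \<subseteq> E \<and> (\<lambda>x. a * f x) = (\<lambda>x. \<Sum>g\<in>F. (a * c g) * g x)"
    by (simp add: sum_distrib_left mult.assoc)
  then show ?thesis
    unfolding is_finite_linear_combination_def by (intro exI)
qed

lemma is_finite_linear_combination_add:
  assumes "is_finite_linear_combination E f" and "is_finite_linear_combination E g"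
  shows "is_finite_linear_combination E (\<lambda>x. f x + g x)"
proof -
  obtain F c where F: "finite F" "F \<subseteq> E" "f = (\<lambda>x. \<Sum>h\<in>F. c h * h x)"
    using assms(1) unfolding is_finite_linear_combination_def by blast
  obtain G d where G: "finite G" "G \<subseteq> E" "g = (\<lambda>x. \<Sum>h\<in>G. d h * h x)"
    using assms(2) unfolding is_finite_linear_combination_def by blast
  \<comment> \<open>Padding the coefficients with 0 outside \<open>F\<close> and \<open>G\<close>
    lets both sums run over the union, also where the two sets overlap.\<close>
  define k where "k h = (if h \<in> F then c h else 0) + (if h \<in> G then d h else 0)" for h
  have "f x = (\<Sum>h\<in>F \<union> G. (if h \<in> F then c h else 0) * h x)"
    and "g x = (\<Sum>h\<in>F \<union> G. (if h \<in> G then d h else 0) * h x)" for x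
    using F G by (auto intro!: sum.mono_neutral_cong_left)
  then have "(\<lambda>x. f x + g x) = (\<lambda>x. \<Sum>h\<in>F \<union> G. k h * h x)"
    by (simp add: k_def distrib_right sum.distrib)
  then show ?thesis
    unfolding is_finite_linear_combination_def using F G by (intro exI[of _ "F \<union> G"]) auto
qed

lemma is_finite_linear_combination_sum:
  assumes "finite I" and "\<And>i. i \<in> I \<Longrightarrow> is_finite_linear_combination E (f i)"
  shows "is_finite_linear_combination E (\<lambda>x. \<Sum>i\<in>I. f i x)"
  using assms
  by (induction I rule: finite_induct)
    (simp_all add: is_finite_linear_combination_zero is_finite_linear_combination_add)

text \<open>Expanding the product of two sums reduces the claim to products of members of
  \<open>E\<close>. These need only be combinations over \<open>E\<close>, which leaves room for a
  product that is zero.\<close>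

lemma is_finite_linear_combination_mult:
  assumes "is_finite_linear_combination E f" and "is_finite_linear_combination E g"
    and closed: "\<And>f g. f \<in> E \<Longrightarrow> g \<in> E \<Longrightarrow> is_finite_linear_combination E (\<lambda>x. f x * g x)"
  shows "is_finite_linear_combination E (\<lambda>x. f x * g x)"
proof -
  obtain F c where F: "finite F" "F \<subseteq> E" "f = (\<lambda>x. \<Sum>h\<in>F. c h * h x)"
    using assms(1) unfolding is_finite_linear_combination_def by blast
  obtain G d where G: "finite G" "G \<subseteq> E" "g = (\<lambda>x. \<Sum>h\<in>G. d h * h x)"
    using assms(2) unfolding is_finite_linear_combination_def by blast
  have "(\<lambda>x. f x * g x) = (\<lambda>x. \<Sum>h\<in>F. \<Sum>k\<in>G. (c h * d k) * (h x * k x))"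
    unfolding F G by (simp add: sum_product mult_ac)
  moreover have "is_finite_linear_combination E \<dots>"
    using F G
    by (auto intro!: is_finite_linear_combination_sum is_finite_linear_combination_scale closed)
  ultimately show ?thesis
    by simp
qed

text \<open>The combinations over \<open>E\<close> form an algebra, so containing the generators
  they contain all that is generated. It serves both versions of the principle algebra.\<close>

lemma generated_algebra_finite_linear_combination:
  assumes "f \<in> generated_algebra G"
    and "\<And>g. g \<in> G \<Longrightarrow> is_finite_linear_combination E g"
    and "\<And>f g. f \<in> E \<Longrightarrow> g \<in> E \<Longrightarrow> is_finite_linear_combination E (\<lambda>x. f x * g x)"
  shows "is_finite_linear_combination E f"
  using assms(1)
  by induction
    (auto intro: assms(2,3) is_finite_linear_combination_zero is_finite_linear_combination_add
      is_finite_linear_combination_scale is_finite_linear_combination_mult)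

theorem proposition2p4:
  fixes T :: "'a::complex_banach \<Rightarrow> 'a"
    and T'0 :: "'a \<Rightarrow> 'a"
    and n :: nat
    and e :: "nat \<Rightarrow> 'a"
    and lam :: "nat \<Rightarrow> complex"
  assumes "T'0 = frechet_derivative T (at 0)"
    and "\<exists>B :: 'a set. finite_dimensional_vector_space scaleC B"
    and "diffeomorphism T"
    and "T 0 = 0"
    and "has_power_series_at_0 T"
    and "diagonalizable T'0"
    and "\<forall>\<mu> v. is_eigenvector T'0 \<mu> v \<longrightarrow> \<mu> \<noteq> 0"
    and "n = complex_vector.dim (UNIV :: 'a set)"
    and "is_basis n e"
    and "\<forall>i\<in>{1..n}. is_eigenvector T'0 (lam i) (e i)"
  shows "(\<forall>f\<in>principle_algebra n e.
            is_finite_linear_combination (Collect (koopman_eigenfunction T'0)) f) \<and>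
         (\<forall>f\<in>unital_principle_algebra n e.
            is_finite_linear_combination (Collect (koopman_eigenfunction T'0)) f)"
proof -
  let ?E = "Collect (koopman_eigenfunction T'0)"
  have lin: "clinear T'0"
    using assms(6) by (simp add: diagonalizable_def)
  \<comment> \<open>A vanishing product is no eigenfunction, but it is the empty
    combination.\<close>
  have mult: "is_finite_linear_combination ?E (\<lambda>x. f x * g x)" if "f \<in> ?E" "g \<in> ?E" for f g
    using that koopman_eigenfunction_mult[of T'0 f g]
    by (cases "(\<lambda>x. f x * g x) = (\<lambda>x. 0)")
      (auto simp: is_finite_linear_combination_zero intro: is_finite_linear_combination_base)
  have const: "is_finite_linear_combination ?E (\<lambda>x. c)" for c
    by (cases "c = 0")
      (auto simp: is_finite_linear_combination_zero koopman_eigenfunction_const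
        intro: is_finite_linear_combination_base)
  have principle: "is_finite_linear_combination ?E f" if "f \<in> principle_algebra n e" for f
    using that unfolding principle_algebra_def
    by (rule generated_algebra_finite_linear_combination)
      (use coordinate_functional_eigenfunction[OF assms(9) lin assms(10)] mult in
        \<open>auto intro: is_finite_linear_combination_base\<close>)
  \<comment> \<open>The generators are now the elements already treated and the constants.\<close>
  moreover have "is_finite_linear_combination ?E f" if "f \<in> unital_principle_algebra n e" for f
    using that unfolding unital_principle_algebra_def
    by (rule generated_algebra_finite_linear_combination) (use principle const mult in auto)
  ultimately show ?thesis
    by blast
qed

end
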